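(* Let $\mathcal{G}=(\mathcal{V},\mathcal{E})$ be an undirected coupling graph. The problem of finding a valid prioritization function $p$ that minimizes the number of computation levels $N_L(\mathcal{G},p)$ is equivalent to the problem of finding a proper vertex coloring $\varphi$ of $\mathcal{G}$ that uses $\chi(\mathcal{G})$ colors, with a prioritization function that respects the coloring, in the following sense: the optimal values coincide, $$\min_{p\ \text{valid}} N_L(\mathcal{G},p)=\chi(\mathcal{G}),$$ and for every proper vertex coloring $\varphi$ of $\mathcal{G}$ using exactly $\chi(\mathcal{G})$ colors, every prioritization function $p_{\text{color}}$ that respects $\varphi$ attains this minimum, i.e. $N_L(\mathcal{G},p_{\text{color}})=\min_{p\ \text{valid}}N_L(\mathcal{G},p)$.
   Context: An undirected coupling graph $\mathcal{G}=(\mathcal{V},\mathcal{E})$ is a finite simple undirected graph (no loops) with vertex set $\mathcal{V}=\{1,\dots,N_A\}$, $N_A\ge 1$; vertices represent agents and edges represent couplings between agents. A prioritization function is a map $p\colon\mathcal{V}\to\mathbb{N}$; it is valid if $p(i)\neq p(j)$ whenever $i$ and $j$ are adjacent in $\mathcal{G}$. Given a valid $p$, the directed coupling graph $\vec{\mathcal{G}}=(\mathcal{V},\vec{\mathcal{E}})$ is obtained by orienting each edge of $\mathcal{G}$ toward the vertex with the larger value of $p$: $(i\to j)\in\vec{\mathcal{E}}$ if and only if $i,j$ are adjacent in $\mathcal{G}$ and $p(i)<p(j)$. This is a directed acyclic graph. The number of computation levels $N_L(\mathcal{G},p)$ is the length of the longest directed path in $\vec{\mathcal{G}}$ (from a vertex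 without incoming edges to a vertex without outgoing edges), counted as the number of vertices on the path, i.e. the highest number of sequentially planning agents. A proper vertex coloring is a map $\varphi\colon\mathcal{V}\to\mathcal{C}$ with $\mathcal{C}\subset\mathbb{N}_{>0}$ such that $\varphi(i)\neq\varphi(j)$ for adjacent $i,j$. Write $\mathcal{V}_c=\{i\in\mathcal{V}\mid\varphi(i)=c\}$; the number of colors used is the number of $c\in\mathcal{C}$ with $\mathcal{V}_c\neq\emptyset$. The chromatic number $\chi(\mathcal{G})$ is the smallest number of colors used by a proper vertex coloring of $\mathcal{G}$. A prioritization function $p_{\text{color}}$ respects $\varphi$ if for all used colors $c_1,c_2$: ($p_{\text{color}}(i)<p_{\text{color}}(j)$ for all $i\in\mathcal{V}_{c_1}$ and all $j\in\mathcal{V}_{c_2}$) if and only if $c_1<c_2$. Such a function is automatically valid. *)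

theory Defs
  imports "Graph_Theory.Graph_Theory"
begin

text \<open>
  Finite simple undirected graphs are represented, as in the locale \<^locale>\<open>pair_graph\<close>, by finite
  loop-free symmetric digraphs: an undirected edge between \<open>i\<close> and \<open>j\<close> is the pair of arcs
  \<open>(i, j)\<close> and \<open>(j, i)\<close>. Prioritizations and colorings are total functions of which only the values
  on the vertices matter.
\<close>

definition valid_prioritization :: "nat pair_pre_digraph \<Rightarrow> (nat \<Rightarrow> nat) \<Rightarrow> bool" where
  "valid_prioritization G p \<longleftrightarrow> (\<forall>i\<in>pverts G. \<forall>j\<in>pverts G. i \<rightarrow>\<^bsub>G\<^esub> j \<longrightarrow> p i \<noteq> p j)"

definition directed_coupling_graph ::
    "nat pair_pre_digraph \<Rightarrow> (nat \<Rightarrow> nat) \<Rightarrow> nat pair_pre_digraph" where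
  "directed_coupling_graph G p =
     \<lparr> pverts = pverts G, parcs = {(i, j). i \<rightarrow>\<^bsub>G\<^esub> j \<and> p i < p j} \<rparr>"

definition source_sink_path :: "nat pair_pre_digraph \<Rightarrow> nat list \<Rightarrow> bool" where
  "source_sink_path D xs \<longleftrightarrow>
     vpath xs (with_proj D) \<and> in_arcs D (hd xs) = {} \<and> out_arcs D (last xs) = {}"

text \<open>Path length counts vertices, hence \<^const>\<open>length\<close> rather than \<^const>\<open>vwalk_length\<close>.\<close>

definition num_levels :: "nat pair_pre_digraph \<Rightarrow> (nat \<Rightarrow> nat) \<Rightarrow> nat" where
  "num_levels G p = Max {length xs | xs. source_sink_path (directed_coupling_graph G p) xs}"

definition min_levels :: "nat pair_pre_digraph \<Rightarrow> nat" where
  "min_levels G = (LEAST n. \<exists>p. valid_prioritization G p \<and> num_levels G p = n)"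

text \<open>
  The color set may be any set of positive numbers. Since only the colors actually used are
  counted, it is taken to be the set of all positive numbers.
\<close>

definition proper_coloring :: "nat pair_pre_digraph \<Rightarrow> (nat \<Rightarrow> nat) \<Rightarrow> bool" where
  "proper_coloring G \<phi> \<longleftrightarrow> \<phi> ` pverts G \<subseteq> {0<..} \<and>
     (\<forall>i\<in>pverts G. \<forall>j\<in>pverts G. i \<rightarrow>\<^bsub>G\<^esub> j \<longrightarrow> \<phi> i \<noteq> \<phi> j)"

definition color_class :: "nat pair_pre_digraph \<Rightarrow> (nat \<Rightarrow> nat) \<Rightarrow> nat \<Rightarrow> nat set" where
  "color_class G \<phi> c = {i \<in> pverts G. \<phi> i = c}"

definition used_colors :: "nat pair_pre_digraph \<Rightarrow> (nat \<Rightarrow> nat) \<Rightarrow> nat set" where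
  "used_colors G \<phi> = {c. color_class G \<phi> c \<noteq> {}}"

definition chromatic_number :: "nat pair_pre_digraph \<Rightarrow> nat" where
  "chromatic_number G = (LEAST k. \<exists>\<phi>. proper_coloring G \<phi> \<and> card (used_colors G \<phi>) = k)"

definition respects_coloring ::
    "nat pair_pre_digraph \<Rightarrow> (nat \<Rightarrow> nat) \<Rightarrow> (nat \<Rightarrow> nat) \<Rightarrow> bool" where
  "respects_coloring G \<phi> p \<longleftrightarrow>
     (\<forall>c1\<in>used_colors G \<phi>. \<forall>c2\<in>used_colors G \<phi>.
        (\<forall>i\<in>color_class G \<phi> c1. \<forall>j\<in>color_class G \<phi> c2. p i < p j) \<longleftrightarrow> c1 < c2)"

text \<open>
  The minima and the maximum above range over nonempty sets, the latter finite, and respecting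
  prioritizations exist.
\<close>

lemma ex_valid_prioritization:
  assumes "pair_graph G"
  shows "\<exists>p. valid_prioritization G p"
proof -
  interpret pair_graph G by fact
  have "valid_prioritization G id"
    unfolding valid_prioritization_def using no_loops' by auto
  then show ?thesis by blast
qed

lemma ex_proper_coloring:
  assumes "pair_graph G"
  shows "\<exists>\<phi>. proper_coloring G \<phi>"
proof -
  interpret pair_graph G by fact
  have "proper_coloring G Suc"
    unfolding proper_coloring_def using no_loops' by auto
  then show ?thesis by blast
qed

lemma respects_coloring_self: "respects_coloring G \<phi> \<phi>"
  unfolding respects_coloring_def used_colors_def color_class_def by auto

lemma finite_path_lengths:
  assumes "pair_graph G"
  shows "finite {length xs | xs. source_sink_path (directed_coupling_graph G p) xs}"
proof -
  interpret pair_graph G by fact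
  have "length xs \<le> card (pverts G)"
    if "source_sink_path (directed_coupling_graph G p) xs" for xs
  proof -
    have "distinct xs" "set xs \<subseteq> pverts G"
      using that by (auto simp: source_sink_path_def vpath_def vwalk_def directed_coupling_graph_def)
    then show ?thesis
      using card_mono[OF pair_finite_verts] distinct_card by metis
  qed
  then show ?thesis
    by (auto intro: finite_subset[of _ "{..card (pverts G)}"])
qed

lemma ex_source_sink_path:
  assumes "pair_graph G" "pverts G \<noteq> {}"
  shows "\<exists>xs. source_sink_path (directed_coupling_graph G p) xs"
proof -
  interpret pair_graph G by fact
  let ?D = "directed_coupling_graph G p"
  have fin: "finite (pverts G)" by (rule pair_finite_verts)
  have arc: "(i, j) \<in> parcs ?D \<longleftrightarrow> (i, j) \<in> parcs G \<and> p i < p j" for i j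
    by (simp add: directed_coupling_graph_def)
  have down: "\<exists>xs. vpath xs (with_proj ?D) \<and> hd xs = v \<and> out_arcs ?D (last xs) = {}
      \<and> (\<forall>x\<in>set xs. p v \<le> p x)" if "v \<in> pverts G" for v
    using that
  proof (induction "Max (p ` pverts G) - p v" arbitrary: v rule: less_induct)
    case less
    show ?case
    proof (cases "out_arcs ?D v = {}")
      case True
      then show ?thesis
        using less.prems
        by (intro exI[of _ "[v]"]) (auto simp: vpath_def vwalk_def directed_coupling_graph_def)
    next
      case False
      then obtain w where w: "(v, w) \<in> parcs ?D" by (auto simp: out_arcs_def)
      then have wG: "w \<in> pverts G" and lt: "p v < p w" using arc in_arcsD2 by auto
      have "p w \<le> Max (p ` pverts G)" using wG fin by auto
      then obtain xs where xs: "vpath xs (with_proj ?D)" "hd xs = w" "out_arcs ?D (last xs) = {}"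
        "\<forall>x\<in>set xs. p w \<le> p x"
        using less.hyps[OF _ wG] lt by (metis diff_less_mono2 less_le_trans)
      then have ne: "xs \<noteq> []" by (auto simp: vpath_def vwalk_def)
      then obtain ys where ys: "xs = w # ys" using xs(2) by (cases xs) auto
      have "vpath (v # xs) (with_proj ?D)"
        using xs w lt less.prems ys
        by (fastforce simp: vpath_def vwalk_def directed_coupling_graph_def)
      then show ?thesis
        using xs lt ne by (intro exI[of _ "v # xs"]) fastforce
    qed
  qed
  obtain v where v: "v \<in> pverts G" "\<forall>u\<in>pverts G. p v \<le> p u"
    using assms(2) ex_has_least_nat[of "\<lambda>u. u \<in> pverts G" _ p] by blast
  then have "in_arcs ?D v = {}"
    using arc in_arcsD1 by (fastforce simp: in_arcs_def)
  then show ?thesis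
    using down[OF v(1)] unfolding source_sink_path_def by metis
qed

end

theory Submission
  imports Defs
begin

text \<open>
  Both directions translate between directed paths and colors. Given a valid prioritization, color
  each vertex by the length of the longest directed path starting there: adjacent vertices get
  different colors, and since a longest path necessarily runs from a source to a sink, no color
  exceeds the number of levels. Conversely, if a prioritization respects a proper coloring, colors
  strictly increase along every directed path, so no path has more vertices than there are colors.
\<close>

lemma vpath_directed_coupling_graph_Cons:
  "vpath (v # w # xs) (with_proj (directed_coupling_graph G p)) \<longleftrightarrow>
     v \<in> pverts G \<and> v \<notin> set (w # xs) \<and> v \<rightarrow>\<^bsub>G\<^esub> w \<and> p v < p w \<and>
     vpath (w # xs) (with_proj (directed_coupling_graph G p))"
  by (auto simp: vpath_def vwalk_def directed_coupling_graph_def)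

text \<open>Each arc raises \<open>f\<close>, and transitivity carries this from consecutive
  vertices to all pairs. Used with \<open>f = p\<close> to exclude repeated vertices and with a
  coloring for \<open>f\<close> to bound path lengths.\<close>

lemma vpath_directed_coupling_graph_sorted:
  assumes "vpath xs (with_proj (directed_coupling_graph G p))"
    and mono: "\<And>i j. i \<rightarrow>\<^bsub>G\<^esub> j \<Longrightarrow> p i < p j \<Longrightarrow> f i < (f j :: nat)"
  shows "sorted_wrt (<) (map f xs)"
  using assms(1)
proof (induction xs)
  case (Cons v xs)
  show ?case
  proof (cases xs)
    case (Cons w ys)
    with Cons.prems have "f v < f w" "vpath xs (with_proj (directed_coupling_graph G p))"
      using mono by (auto simp: vpath_directed_coupling_graph_Cons)
    \<comment> \<open>By transitivity, \<open>sorted_wrt2\<close> only asks to compare the first two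
      entries, whereas \<open>sorted_wrt.simps\<close> would compare the head with every later
      one.\<close>
    with Cons.IH Cons show ?thesis by (simp add: sorted_wrt2 del: sorted_wrt.simps)
  qed simp
qed simp

text \<open>Priorities strictly increase along the path, so a vertex of priority below that of the
  head cannot already lie on it.\<close>

lemma vpath_directed_coupling_graph_ConsI:
  assumes path: "vpath xs (with_proj (directed_coupling_graph G p))"
    and "v \<in> pverts G" "v \<rightarrow>\<^bsub>G\<^esub> hd xs" "p v < p (hd xs)"
  shows "vpath (v # xs) (with_proj (directed_coupling_graph G p))"
proof -
  obtain w ys where xs: "xs = w # ys"
    using path by (cases xs) (auto simp: vpath_def vwalk_def)
  have "sorted_wrt (<) (map p xs)"
    by (rule vpath_directed_coupling_graph_sorted[OF path])
  then have "v \<notin> set xs" using assms(4) by (auto simp: xs)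
  then show ?thesis
    using assms by (simp add: xs vpath_directed_coupling_graph_Cons)
qed

lemma vpath_directed_coupling_graph_snocI:
  assumes path: "vpath xs (with_proj (directed_coupling_graph G p))"
    and "v \<in> pverts G" "last xs \<rightarrow>\<^bsub>G\<^esub> v" "p (last xs) < p v"
  shows "vpath (xs @ [v]) (with_proj (directed_coupling_graph G p))"
  using assms
proof (induction xs)
  case (Cons u xs)
  show ?case
  proof (cases xs)
    case Nil
    with Cons.prems show ?thesis
      by (auto simp: vpath_def vwalk_def directed_coupling_graph_def)
  next
    case (Cons w ys)
    with Cons.prems Cons.IH have "vpath (xs @ [v]) (with_proj (directed_coupling_graph G p))"
      by (simp add: vpath_directed_coupling_graph_Cons)
    then show ?thesis
      using Cons.prems Cons vpath_directed_coupling_graph_ConsI[of "xs @ [v]" G p u]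
      by (simp add: vpath_directed_coupling_graph_Cons)
  qed
qed (simp add: vpath_def vwalk_def)

lemma vpath_length_le_card:
  assumes "pair_graph G" "vpath xs (with_proj (directed_coupling_graph G p))"
  shows "length xs \<le> card (pverts G)"
proof -
  interpret pair_graph G by fact
  have "distinct xs" "set xs \<subseteq> pverts G"
    using assms(2) by (auto simp: vpath_def vwalk_def directed_coupling_graph_def)
  then show ?thesis
    using card_mono[OF pair_finite_verts] distinct_card by metis
qed

text \<open>A path of maximal length that did not start at a source or end at a sink could be
  extended there. So it is among the paths that \<open>num_levels\<close> counts.\<close>

lemma vpath_length_le_num_levels:
  assumes G: "pair_graph G" and path: "vpath xs (with_proj (directed_coupling_graph G p))"
  shows "length xs \<le> num_levels G p"
proof -
  interpret pair_graph G by fact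
  let ?D = "directed_coupling_graph G p"
  let ?P = "\<lambda>ys. vpath ys (with_proj ?D)"
  \<comment> \<open>\<open>ex_has_greatest_nat\<close> expects a strict bound, hence the
    \<open>Suc\<close>.\<close>
  obtain ys where ys: "?P ys" and longest: "\<And>zs. ?P zs \<Longrightarrow> length zs \<le> length ys"
    using ex_has_greatest_nat[of ?P xs length "Suc (card (pverts G))"] path vpath_length_le_card[OF G]
    by (auto simp: less_Suc_eq_le)
  have "in_arcs ?D (hd ys) = {}"
  proof (rule ccontr)
    assume "in_arcs ?D (hd ys) \<noteq> {}"
    then obtain v where "v \<rightarrow>\<^bsub>G\<^esub> hd ys" "p v < p (hd ys)"
      by (auto simp: directed_coupling_graph_def in_arcs_def)
    with ys have "?P (v # ys)"
      by (intro vpath_directed_coupling_graph_ConsI) (auto dest: in_arcsD1)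
    from longest[OF this] show False by simp
  qed
  moreover have "out_arcs ?D (last ys) = {}"
  proof (rule ccontr)
    assume "out_arcs ?D (last ys) \<noteq> {}"
    then obtain v where "last ys \<rightarrow>\<^bsub>G\<^esub> v" "p (last ys) < p v"
      by (auto simp: directed_coupling_graph_def out_arcs_def)
    with ys have "?P (ys @ [v])"
      by (intro vpath_directed_coupling_graph_snocI) (auto dest: in_arcsD2)
    from longest[OF this] show False by simp
  qed
  ultimately have "source_sink_path ?D ys"
    using ys by (simp add: source_sink_path_def)
  then have "length ys \<le> num_levels G p"
    unfolding num_levels_def by (intro Max_ge finite_path_lengths[OF G]) auto
  with longest[OF path] show ?thesis by simp
qed

lemma chromatic_number_le_num_levels:
  assumes G: "pair_graph G" and valid: "valid_prioritization G p"
  shows "chromatic_number G \<le> num_levels G p"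
proof -
  interpret pair_graph G by fact
  let ?D = "directed_coupling_graph G p"
  define L where "L v = {length xs | xs. vpath xs (with_proj ?D) \<and> hd xs = v}" for v
  define \<phi> where "\<phi> v = Max (L v)" for v
  have fin: "finite (L v)" for v
    using vpath_length_le_card[OF G]
    by (auto simp: L_def intro: finite_subset[of _ "{..card (pverts G)}"])
  \<comment> \<open>The one-vertex path ensures that the maximum of \<open>L v\<close> is attained
    and that colors are positive.\<close>
  have single: "1 \<in> L v" if "v \<in> pverts G" for v
    using that unfolding L_def
    by (auto simp: vpath_def vwalk_def directed_coupling_graph_def intro!: exI[of _ "[v]"])
  have \<phi>_in: "\<phi> v \<in> L v" if "v \<in> pverts G" for v
    unfolding \<phi>_def using Max_in[OF fin] single[OF that] by blast
  have range: "\<phi> v \<in> {1..num_levels G p}" if "v \<in> pverts G" for v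
  proof -
    have "1 \<le> \<phi> v" unfolding \<phi>_def by (rule Max_ge[OF fin single[OF that]])
    moreover have "\<phi> v \<le> num_levels G p"
      using \<phi>_in[OF that] vpath_length_le_num_levels[OF G] by (auto simp: L_def)
    ultimately show ?thesis by simp
  qed
  \<comment> \<open>Prepending \<open>i\<close> to a longest path from \<open>j\<close> gives a
    longer path from \<open>i\<close>. Colors thus run against the priorities, which is harmless
    since only their distinctness matters.\<close>
  have less: "\<phi> j < \<phi> i" if "i \<rightarrow>\<^bsub>G\<^esub> j" "p i < p j" for i j
  proof -
    have vert: "i \<in> pverts G" "j \<in> pverts G" using that(1) in_arcsD1 in_arcsD2 by auto
    obtain xs where xs: "vpath xs (with_proj ?D)" "hd xs = j" "length xs = \<phi> j"
      using \<phi>_in[OF vert(2)] by (auto simp: L_def)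
    then have "vpath (i # xs) (with_proj ?D)"
      using that vert by (intro vpath_directed_coupling_graph_ConsI) auto
    then have "length (i # xs) \<in> L i" unfolding L_def by force
    then have "length (i # xs) \<le> \<phi> i" unfolding \<phi>_def by (rule Max_ge[OF fin])
    with xs show ?thesis by simp
  qed
  have "\<phi> i \<noteq> \<phi> j" if "i \<in> pverts G" "j \<in> pverts G" "i \<rightarrow>\<^bsub>G\<^esub> j" for i j
  proof -
    \<comment> \<open>Whichever endpoint has the smaller priority, \<open>less\<close> applies to
      one of the two arcs of the edge.\<close>
    have "j \<rightarrow>\<^bsub>G\<^esub> i" using that(3) arcs_symmetric by auto
    moreover have "p i \<noteq> p j" using valid that by (auto simp: valid_prioritization_def)
    ultimately show ?thesis using less that(3) by (metis less_irrefl linorder_neqE_nat)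
  qed
  then have "proper_coloring G \<phi>"
    using range unfolding proper_coloring_def by fastforce
  then have "chromatic_number G \<le> card (used_colors G \<phi>)"
    unfolding chromatic_number_def by (blast intro: Least_le)
  also have "\<dots> \<le> card {1..num_levels G p}"
    using range by (intro card_mono) (auto simp: used_colors_def color_class_def)
  finally show ?thesis by simp
qed

text \<open>The definition compares whole color classes; its instance for the classes of two
  vertices gives one implication. As the colors differ, exchanging the vertices gives the
  other.\<close>

lemma respects_coloring_less_iff:
  assumes "respects_coloring G \<phi> p" "i \<in> pverts G" "j \<in> pverts G" "\<phi> i \<noteq> \<phi> j"
  shows "p i < p j \<longleftrightarrow> \<phi> i < \<phi> j"
proof -
  have imp: "p u < p v" if "u \<in> pverts G" "v \<in> pverts G" "\<phi> u < \<phi> v" for u v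
    using assms(1) that unfolding respects_coloring_def used_colors_def color_class_def by blast
  then show ?thesis
    using assms(2-4) by (metis less_asym linorder_neqE_nat)
qed

lemma respects_coloring_valid:
  assumes "proper_coloring G \<phi>" "respects_coloring G \<phi> p"
  shows "valid_prioritization G p"
proof -
  have "p i \<noteq> p j" if "i \<in> pverts G" "j \<in> pverts G" "i \<rightarrow>\<^bsub>G\<^esub> j" for i j
  proof -
    have "\<phi> i \<noteq> \<phi> j" using assms(1) that by (simp add: proper_coloring_def)
    then show ?thesis
      using respects_coloring_less_iff[OF assms(2)] that by (metis less_irrefl linorder_neqE_nat)
  qed
  then show ?thesis by (simp add: valid_prioritization_def)
qed

lemma num_levels_le_card_used_colors:
  assumes G: "pair_graph G" "pverts G \<noteq> {}"
    and \<phi>: "proper_coloring G \<phi>" "respects_coloring G \<phi> p"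
  shows "num_levels G p \<le> card (used_colors G \<phi>)"
proof -
  interpret pair_graph G by fact
  let ?D = "directed_coupling_graph G p"
  have used: "used_colors G \<phi> = \<phi> ` pverts G"
    by (auto simp: used_colors_def color_class_def)
  have mono: "\<phi> i < \<phi> j" if "i \<rightarrow>\<^bsub>G\<^esub> j" "p i < p j" for i j
  proof -
    have vert: "i \<in> pverts G" "j \<in> pverts G" using that(1) in_arcsD1 in_arcsD2 by auto
    then have "\<phi> i \<noteq> \<phi> j" using \<phi>(1) that(1) by (simp add: proper_coloring_def)
    then show ?thesis using respects_coloring_less_iff[OF \<phi>(2)] vert that(2) by blast
  qed
  have "length xs \<le> card (used_colors G \<phi>)" if "source_sink_path ?D xs" for xs
  proof -
    have path: "vpath xs (with_proj ?D)" using that by (simp add: source_sink_path_def)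
    have "sorted_wrt (<) (map \<phi> xs)"
      by (rule vpath_directed_coupling_graph_sorted[OF path mono])
    \<comment> \<open>The coloring is injective on the path, so the path has as many vertices as
      colors.\<close>
    then have "distinct (map \<phi> xs)" by (simp only: strict_sorted_iff)
    then have "length xs = card (\<phi> ` set xs)" using distinct_card by fastforce
    also have "\<dots> \<le> card (used_colors G \<phi>)"
      unfolding used using path
      by (intro card_mono) (auto simp: vpath_def vwalk_def directed_coupling_graph_def)
    finally show ?thesis .
  qed
  \<comment> \<open>A source-sink path exists because there are vertices, so \<open>Max\<close> is
    not taken over the empty set.\<close>
  then show ?thesis
    unfolding num_levels_def
    using finite_path_lengths[OF G(1)] ex_source_sink_path[OF G] by (subst Max_le_iff) auto
qed

theorem theorem2:
  fixes G :: "nat pair_pre_digraph" and N :: nat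
  assumes "N \<ge> 1"
    and "pverts G = {1..N}"
    and "pair_graph G"
  shows "min_levels G = chromatic_number G \<and>
    (\<forall>\<phi> p. proper_coloring G \<phi> \<and> card (used_colors G \<phi>) = chromatic_number G \<and>
        respects_coloring G \<phi> p \<longrightarrow>
      valid_prioritization G p \<and> num_levels G p = min_levels G)"
proof -
  have ne: "pverts G \<noteq> {}" using assms(1,2) by simp
  \<comment> \<open>The number of levels lies between \<open>chromatic_number G\<close> and
    \<open>card (used_colors G \<phi>)\<close>, which coincide here.\<close>
  have upper: "num_levels G p = chromatic_number G \<and> valid_prioritization G p"
    if "proper_coloring G \<phi>" "card (used_colors G \<phi>) = chromatic_number G"
      "respects_coloring G \<phi> p" for \<phi> p
    using num_levels_le_card_used_colors[OF assms(3) ne that(1,3)]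
      respects_coloring_valid[OF that(1,3)] chromatic_number_le_num_levels[OF assms(3)] that(2)
    by (simp add: le_antisym)
  have "\<exists>\<phi>. proper_coloring G \<phi> \<and> card (used_colors G \<phi>) = chromatic_number G"
    unfolding chromatic_number_def
    by (rule LeastI_ex) (use ex_proper_coloring[OF assms(3)] in blast)
  then obtain \<phi> where "proper_coloring G \<phi>" "card (used_colors G \<phi>) = chromatic_number G"
    by blast
  \<comment> \<open>An optimal coloring respects itself, so \<open>\<phi>\<close> taken as a
    prioritization attains the lower bound.\<close>
  from upper[OF this respects_coloring_self] have "min_levels G = chromatic_number G"
    unfolding min_levels_def
    using chromatic_number_le_num_levels[OF assms(3)] by (intro Least_equality) auto
  with upper show ?thesis by auto
qed

end
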